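(* Let $I\subseteq\mathbb{R}$ be an interval with interior $I^\circ$, let $a,b\in I^\circ$ with $a<b$, and let $f:I\to\mathbb{R}$ be differentiable on $I^\circ$. Let $g:[a,b]\to[0,\infty)$ be a differentiable function that is symmetric to $\frac{a+b}{2}$. Let $h:[0,1]\to[0,\infty)$ be a function with $h\not\equiv 0$. If $|f'|$ is $h$-convex on $[a,b]$, then $$\left|\frac{f(a)+f(b)}{2}\int_a^b g(x)\,dx-\int_a^b f(x)g(x)\,dx\right|\leq (b-a)\big(|f'(a)|+|f'(b)|\big)\int_a^{\frac{a+b}{2}}\int_0^{\frac{x-a}{b-a}} g(x)\big[h(t)+h(1-t)\big]\,dt\,dx.$$
   Context: A function $g:[a,b]\to\mathbb{R}$ is symmetric to $\frac{a+b}{2}$ if $g(x)=g(a+b-x)$ for all $x\in[a,b]$. Let $h:[0,1]\to[0,\infty)$ with $h\not\equiv 0$. A nonnegative function $\varphi:J\to[0,\infty)$ on an interval $J$ is called $h$-convex if for all $x,y\in J$ and all $\lambda\in[0,1]$, $$\varphi(\lambda x+(1-\lambda)y)\le h(\lambda)\varphi(x)+h(1-\lambda)\varphi(y).$$ *)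

theory Defs
  imports "HOL-Analysis.Analysis"
begin

definition symmetric_to_midpoint :: "real \<Rightarrow> real \<Rightarrow> (real \<Rightarrow> real) \<Rightarrow> bool" where
  "symmetric_to_midpoint a b g \<longleftrightarrow> (\<forall>x\<in>{a..b}. g x = g (a + b - x))"

text \<open>A function \<open>h : [0,1] \<rightarrow> [0,\<infinity>)\<close> that is not identically zero; only the values of
  \<open>h\<close> on \<open>[0,1]\<close> matter.\<close>

definition h_function :: "(real \<Rightarrow> real) \<Rightarrow> bool" where
  "h_function h \<longleftrightarrow> (\<forall>t\<in>{0..1}. 0 \<le> h t) \<and> (\<exists>t\<in>{0..1}. h t \<noteq> 0)"

definition h_convex_on :: "(real \<Rightarrow> real) \<Rightarrow> real set \<Rightarrow> (real \<Rightarrow> real) \<Rightarrow> bool" where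
  "h_convex_on h J \<phi> \<longleftrightarrow>
     is_interval J \<and> (\<forall>x\<in>J. 0 \<le> \<phi> x) \<and>
     (\<forall>x\<in>J. \<forall>y\<in>J. \<forall>l\<in>{0..1}.
        \<phi> (l * x + (1 - l) * y) \<le> h l * \<phi> x + h (1 - l) * \<phi> y)"

text \<open>
  Convention for the iterated integral of \<open>g(x) [h(t) + h(1-t)]\<close>: nothing is assumed about
  integrability of \<open>h\<close>, so this nonnegative integrand is integrated with values in
  \<open>[0,\<infinity>]\<close> (\<^const>\<open>nn_integral\<close>). This is the real-valued integral
  whenever that exists, and avoids the value 0 that total real-valued integrals assign to
  non-integrable functions.
\<close>

end

theory Submission imports Defs begin

text \<open>
  Put \<open>m = (a + b) / 2\<close>. Since \<open>g\<close> is symmetric, both integrals on the left fold onto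
  \<open>[a, m]\<close> (lemma \<open>integral_fold_at_midpoint\<close>), and the left-hand side becomes the absolute
  value of \<open>\<integral> g(x) (f(x) + f(a+b-x) - f(a) - f(b)) dx\<close> over \<open>[a, m]\<close>. With
  \<open>P(t) = f(a + t(b-a)) + f(b - t(b-a))\<close> and \<open>s(x) = (x-a)/(b-a)\<close> the bracket is the
  increment \<open>P(s(x)) - P(0)\<close>. The two arguments of \<open>f\<close> are the convex combinations
  of \<open>a\<close> and \<open>b\<close> with weights \<open>t\<close> and \<open>1-t\<close> interchanged, so adding the two \<open>h\<close>-convexity
  estimates gives \<open>\<bar>P'(t)\<bar> \<le> (b-a) (\<bar>f'(a)\<bar> + \<bar>f'(b)\<bar>) (h(t) + h(1-t))\<close>, and integrating
  this bound twice yields the right-hand side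
  (lemma \<open>weighted_increment_le_iterated_nn_integral\<close>).

  Two points of integration theory need care. The derivative \<open>f'\<close> need not be Lebesgue
  integrable; but it is Henstock--Kurzweil integrable to the increment of \<open>f\<close>, hence
  measurable, so either \<open>\<bar>f'\<bar>\<close> has infinite integral or the usual bound on increments
  holds (lemma \<open>abs_increment_le_nn_integral_abs_deriv\<close>). The function \<open>h\<close> need not even be
  measurable, in which case the nonnegative integral is a lower integral. This is still
  monotone, and monotonicity is all that is used of the integrals involving \<open>h\<close>: they are
  compared with integrals of the measurable function \<open>\<bar>P'\<bar>\<close>, on which the algebra is done.
\<close>

text \<open>
  If the right-hand side is finite, the derivative is Lebesgue integrable and its Lebesgue and
  Henstock--Kurzweil integrals agree, so the fundamental theorem of calculus applies.
\<close>

lemma abs_increment_le_nn_integral_abs_deriv: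
  fixes F F' :: "real \<Rightarrow> real"
  assumes "c \<le> d"
    and der: "\<And>x. x \<in> {c..d} \<Longrightarrow> (F has_real_derivative F' x) (at x within {c..d})"
  shows "ennreal \<bar>F d - F c\<bar> \<le> (\<integral>\<^sup>+x\<in>{c..d}. ennreal \<bar>F' x\<bar> \<partial>lebesgue)"
proof (cases "(\<integral>\<^sup>+x\<in>{c..d}. ennreal \<bar>F' x\<bar> \<partial>lebesgue) < \<infinity>")
  case False
  then show ?thesis
    by (metis infinity_ennreal_def less_top top_greatest)
next
  case True
  have ftc: "(F' has_integral (F d - F c)) {c..d}"
    using assms
    by (intro fundamental_theorem_of_calculus)
      (auto simp: has_real_derivative_iff_has_vector_derivative)
  let ?G = "\<lambda>x. indicator {c..d} x *\<^sub>R F' x"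
  have norm_G: "ennreal (norm (?G x)) = ennreal \<bar>F' x\<bar> * indicator {c..d} x" for x
    by (simp add: indicator_def)
  have "?G \<in> borel_measurable lebesgue"
    using ftc by (rule has_integral_implies_lebesgue_measurable)
  then have int: "integrable lebesgue ?G"
    using True by (simp only: integrable_iff_bounded norm_G)
  then have set_int: "set_integrable lebesgue {c..d} F'"
    by (simp add: set_integrable_def)
  have "integral\<^sup>L lebesgue ?G = F d - F c"
    using has_integral_unique[OF has_integral_set_lebesgue[OF set_int] ftc]
    by (simp add: set_lebesgue_integral_def)
  with integral_norm_bound_ennreal[OF int] show ?thesis
    by (simp only: norm_G) (simp only: real_norm_def)
qed

lemma integral_fold_at_midpoint:
  fixes \<phi> :: "real \<Rightarrow> real"
  assumes "a \<le> b" and cont: "continuous_on {a..b} \<phi>"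
  shows "integral {a..b} \<phi> = integral {a..(a + b) / 2} (\<lambda>x. \<phi> x + \<phi> (a + b - x))"
proof -
  let ?m = "(a + b) / 2"
  have left: "\<phi> integrable_on {a..?m}"
    using \<open>a \<le> b\<close>
    by (intro integrable_continuous_real continuous_on_subset[OF cont]) auto
  have "\<phi> integrable_on {?m..b}"
    using \<open>a \<le> b\<close>
    by (intro integrable_continuous_real continuous_on_subset[OF cont]) auto
  then have "(\<phi> has_integral integral {?m..b} \<phi>) {?m..b}"
    by (rule integrable_integral)
  then have "((\<lambda>x. \<phi> (- x)) has_integral integral {?m..b} \<phi>) {- b..- ?m}"
    by simp
  from has_integral_shift_real_ivl[OF this, of "- (a + b)"]
  have right: "((\<lambda>x. \<phi> (a + b - x)) has_integral integral {?m..b} \<phi>) {a..?m}"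
    by (simp add: field_simps)
  have "integral {a..b} \<phi> = integral {a..?m} \<phi> + integral {?m..b} \<phi>"
    using \<open>a \<le> b\<close>
    by (intro Henstock_Kurzweil_Integration.integral_combine[symmetric]
        integrable_continuous_real[OF cont]) auto
  also have "\<dots> = integral {a..?m} (\<lambda>x. \<phi> x + \<phi> (a + b - x))"
    using has_integral_add[OF integrable_integral[OF left] right] by (simp add: integral_unique)
  finally show ?thesis .
qed

text \<open>
  \<open>H\<close> is arbitrary, so the inner integrals and the outer integrand may fail to be measurable.
  Bounding the inner integral below by a continuous function of \<open>x\<close> first means that the outer
  integral only has to be evaluated for that continuous function. Dividing the pointwise bound
  by \<open>K\<close>, instead of moving \<open>K\<close> into the integral on the right, keeps every multiplicativity
  step on a measurable integrand.
\<close>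

lemma weighted_increment_le_iterated_nn_integral:
  fixes P p g s H :: "real \<Rightarrow> real"
  assumes "0 \<le> K"
    and g0: "\<And>x. x \<in> {a..c} \<Longrightarrow> 0 \<le> g x" and g_cont: "continuous_on {a..c} g"
    and s01: "\<And>x. x \<in> {a..c} \<Longrightarrow> s x \<in> {0..1}" and s_cont: "continuous_on {a..c} s"
    and der: "\<And>t. t \<in> {0..1} \<Longrightarrow> (P has_real_derivative p t) (at t within {0..1})"
    and bound: "\<And>t. t \<in> {0..1} \<Longrightarrow> \<bar>p t\<bar> \<le> K * H t"
  shows "ennreal (integral {a..c} (\<lambda>x. g x * \<bar>P (s x) - P 0\<bar>))
    \<le> ennreal K *
      (\<integral>\<^sup>+x\<in>{a..c}. (\<integral>\<^sup>+t\<in>{0..s x}. ennreal (g x * H t) \<partial>lebesgue) \<partial>lebesgue)"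
    (is "ennreal (integral _ ?w) \<le> _ * ?R")
proof -
  have increment: "ennreal \<bar>P u - P 0\<bar> \<le> (\<integral>\<^sup>+t\<in>{0..u}. ennreal \<bar>p t\<bar> \<partial>lebesgue)"
    if "u \<in> {0..1}" for u
    using that
    by (intro abs_increment_le_nn_integral_abs_deriv) (auto intro: DERIV_subset[OF der])
  show ?thesis
  proof (cases "K = 0")
    case True
    have "P u = P 0" if u: "u \<in> {0..1}" for u
    proof -
      have "(\<integral>\<^sup>+t\<in>{0..u}. ennreal \<bar>p t\<bar> \<partial>lebesgue) = (\<integral>\<^sup>+t. 0 \<partial>(lebesgue :: real measure))"
        using bound u True by (intro nn_integral_cong) (auto simp: indicator_def)
      with increment[OF u] show ?thesis by simp
    qed
    then have "integral {a..c} ?w = integral {a..c} (\<lambda>x. 0)"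
      using s01 by (intro integral_cong) (metis abs_zero diff_self mult_zero_right)
    then show ?thesis by simp
  next
    case False
    with \<open>0 \<le> K\<close> have K: "0 < K" by simp
    have "continuous_on {0..1} P"
      using der by (meson DERIV_continuous continuous_on_eq_continuous_within)
    then have "continuous_on {a..c} (\<lambda>x. P (s x))"
      using s01 by (intro continuous_on_compose2[OF _ s_cont]) auto
    then have w_cont: "continuous_on {a..c} ?w"
      by (intro continuous_intros g_cont)
    have inner: "ennreal (?w x / K) \<le> (\<integral>\<^sup>+t\<in>{0..s x}. ennreal (g x * H t) \<partial>lebesgue)"
      if x: "x \<in> {a..c}" for x
    proof -
      have sx: "0 \<le> s x" "s x \<le> 1" using s01[OF x] by auto
      have "(p has_integral (P (s x) - P 0)) {0..s x}"
        using sx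
        by (intro fundamental_theorem_of_calculus)
          (auto intro: DERIV_subset[OF der]
            simp flip: has_real_derivative_iff_has_vector_derivative)
      then have "(\<lambda>t. indicator {0..s x} t *\<^sub>R p t) \<in> borel_measurable lebesgue"
        by (rule has_integral_implies_lebesgue_measurable)
      then have "(\<lambda>t. ennreal \<bar>indicator {0..s x} t *\<^sub>R p t\<bar>) \<in> borel_measurable lebesgue"
        by measurable
      then have meas: "(\<lambda>t. ennreal \<bar>p t\<bar> * indicator {0..s x} t) \<in> borel_measurable lebesgue"
        by (rule measurable_cong[THEN iffD1, rotated]) (simp add: indicator_def)
      have "ennreal (?w x / K) = ennreal (g x / K) * ennreal \<bar>P (s x) - P 0\<bar>"
        using g0[OF x] K by (simp flip: ennreal_mult)
      also have "\<dots> \<le> ennreal (g x / K) * (\<integral>\<^sup>+t\<in>{0..s x}. ennreal \<bar>p t\<bar> \<partial>lebesgue)"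
        by (intro mult_left_mono increment s01 x) simp
      also have "\<dots> = (\<integral>\<^sup>+t. ennreal (g x / K) * (ennreal \<bar>p t\<bar> * indicator {0..s x} t) \<partial>lebesgue)"
        using meas by (simp add: nn_integral_cmult)
      also have "\<dots> \<le> (\<integral>\<^sup>+t\<in>{0..s x}. ennreal (g x * H t) \<partial>lebesgue)"
      proof (intro nn_integral_mono)
        fix t
        show "ennreal (g x / K) * (ennreal \<bar>p t\<bar> * indicator {0..s x} t)
          \<le> ennreal (g x * H t) * indicator {0..s x} t"
        proof (cases "t \<in> {0..s x}")
          case True
          then have "\<bar>p t\<bar> / K \<le> H t"
            using bound[of t] sx K by (simp add: field_simps)
          then have "g x * (\<bar>p t\<bar> / K) \<le> g x * H t"
            using g0[OF x] by (rule mult_left_mono)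
          then show ?thesis
            using True g0[OF x] K by (simp flip: ennreal_mult add: ennreal_leI)
        qed simp
      qed
      finally show ?thesis .
    qed
    have w_int: "((\<lambda>x. ?w x / K) has_integral (integral {a..c} ?w / K)) {a..c}"
      by (intro has_integral_divide integrable_integral integrable_continuous_real w_cont)
    have "ennreal (integral {a..c} ?w) = ennreal K * ennreal (integral {a..c} ?w / K)"
      using K g0 by (simp flip: ennreal_mult' add: integral_nonneg)
    also have "ennreal (integral {a..c} ?w / K) = (\<integral>\<^sup>+x\<in>{a..c}. ennreal (?w x / K) \<partial>lebesgue)"
      using nn_integral_has_integral_lebesgue'[OF _ w_int] g0 K
      by (simp add: nn_integral_completion)
    also have "\<dots> \<le> ?R"
      by (intro nn_integral_mono) (simp add: inner split: split_indicator)
    finally show ?thesis by (simp add: mult_left_mono)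
  qed
qed

theorem theorem2p5:
  fixes I :: "real set" and a b :: real and f g h :: "real \<Rightarrow> real"
  assumes "is_interval I"
    and "a \<in> interior I" and "b \<in> interior I" and "a < b"
    and "f differentiable_on interior I"
    and "\<forall>x\<in>{a..b}. 0 \<le> g x"
    and "g differentiable_on {a..b}"
    and "symmetric_to_midpoint a b g"
    and "h_function h"
    and "h_convex_on h {a..b} (\<lambda>x. \<bar>deriv f x\<bar>)"
  shows "ennreal \<bar>(f a + f b) / 2 * integral {a..b} g - integral {a..b} (\<lambda>x. f x * g x)\<bar>
    \<le> ennreal ((b - a) * (\<bar>deriv f a\<bar> + \<bar>deriv f b\<bar>)) *
      (\<integral>\<^sup>+ x\<in>{a..(a + b) / 2}.
        (\<integral>\<^sup>+ t\<in>{0..(x - a) / (b - a)}. ennreal (g x * (h t + h (1 - t))) \<partial>lebesgue) \<partial>lebesgue)"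
proof -
  define m where "m = (a + b) / 2"
  define s where "s x = (x - a) / (b - a)" for x
  define P where "P t = f (a + t * (b - a)) + f (b - t * (b - a))" for t
  define p where "p t = (b - a) * (deriv f (a + t * (b - a)) - deriv f (b - t * (b - a)))" for t
  define M where "M = \<bar>deriv f a\<bar> + \<bar>deriv f b\<bar>"
  have ab: "a < b" by fact
  have m: "a < m" "m < b" using ab by (auto simp: m_def)
  have g_cont: "continuous_on {a..b} g"
    using assms(7) by (rule differentiable_imp_continuous_on)
  have g_sym: "g (a + b - x) = g x" if "x \<in> {a..b}" for x
    using assms(8) that unfolding symmetric_to_midpoint_def by metis

  have "convex (interior I)"
    using assms(1) by (simp add: is_interval_convex convex_interior)
  then have "{a..b} \<subseteq> interior I"
    using assms(2,3) ab closed_segment_subset[of a "interior I" b]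
    by (simp add: closed_segment_eq_real_ivl)
  then have f_der: "(f has_real_derivative deriv f x) (at x)" if "x \<in> {a..b}" for x
    using assms(5) that
    by (auto simp: DERIV_deriv_iff_real_differentiable differentiable_on_eq_differentiable_at)
  have f_cont: "continuous_on {a..b} f"
    using f_der by (meson DERIV_isCont continuous_at_imp_continuous_on)

  have arg: "a + t * (b - a) \<in> {a..b}" "b - t * (b - a) \<in> {a..b}" if "t \<in> {0..1}" for t
  proof -
    have "0 \<le> t * (b - a)" "t * (b - a) \<le> b - a"
      using that ab by (simp_all add: mult_left_le_one_le)
    then show "a + t * (b - a) \<in> {a..b}" "b - t * (b - a) \<in> {a..b}"
      by simp_all
  qed
  have P_der: "(P has_real_derivative p t) (at t within {0..1})" if t: "t \<in> {0..1}" for t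
  proof -
    have "((\<lambda>t. f (a + t * (b - a))) has_real_derivative deriv f (a + t * (b - a)) * (b - a))
        (at t within {0..1})"
      by (rule DERIV_chain2, rule f_der[OF arg(1)[OF t]]) (auto intro!: derivative_eq_intros)
    moreover have "((\<lambda>t. f (b - t * (b - a))) has_real_derivative
        deriv f (b - t * (b - a)) * - (b - a)) (at t within {0..1})"
      by (rule DERIV_chain2, rule f_der[OF arg(2)[OF t]]) (auto intro!: derivative_eq_intros)
    ultimately show ?thesis
      unfolding P_def p_def by (rule DERIV_add[THEN DERIV_cong]) (simp add: algebra_simps)
  qed

  have p_bound: "\<bar>p t\<bar> \<le> (b - a) * M * (h t + h (1 - t))" if t: "t \<in> {0..1}" for t
  proof -
    have conv: "\<bar>deriv f (l * x + (1 - l) * y)\<bar> \<le> h l * \<bar>deriv f x\<bar> + h (1 - l) * \<bar>deriv f y\<bar>"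
      if "x \<in> {a..b}" "y \<in> {a..b}" "l \<in> {0..1}" for x y l
      using assms(10) that unfolding h_convex_on_def by blast
    have eq: "t * b + (1 - t) * a = a + t * (b - a)" "t * a + (1 - t) * b = b - t * (b - a)"
      by (simp_all add: algebra_simps)
    have "\<bar>deriv f (a + t * (b - a))\<bar> \<le> h t * \<bar>deriv f b\<bar> + h (1 - t) * \<bar>deriv f a\<bar>"
      using conv[of b a t] t ab by (simp add: eq)
    moreover have "\<bar>deriv f (b - t * (b - a))\<bar> \<le> h t * \<bar>deriv f a\<bar> + h (1 - t) * \<bar>deriv f b\<bar>"
      using conv[of a b t] t ab by (simp add: eq)
    ultimately have "\<bar>deriv f (a + t * (b - a)) - deriv f (b - t * (b - a))\<bar>
        \<le> M * (h t + h (1 - t))"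
      unfolding M_def distrib_left distrib_right
      by (smt (verit) mult.commute)
    then show ?thesis
      using ab by (simp add: p_def abs_mult mult.assoc mult_left_mono)
  qed

  have P_s: "P (s x) - P 0 = f x + f (a + b - x) - (f a + f b)" for x
  proof -
    have "a + s x * (b - a) = x" "b - s x * (b - a) = a + b - x"
      using ab by (simp_all add: s_def)
    then show ?thesis
      unfolding P_def by (simp only: mult_zero_left add_0_right diff_zero)
  qed
  have sub: "{a..m} \<subseteq> {a..b}" using m by auto
  have refl_cont: "continuous_on {a..m} (\<lambda>x. f (a + b - x))"
    using m by (intro continuous_on_compose2[OF f_cont]) (auto intro!: continuous_intros)
  have D_cont: "continuous_on {a..m} (\<lambda>x. P (s x) - P 0)"
    unfolding P_s by (intro continuous_intros refl_cont continuous_on_subset[OF f_cont sub])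
  have g_cont': "continuous_on {a..m} g"
    using g_cont sub by (rule continuous_on_subset)

  \<comment> \<open>Folding at \<open>m\<close> doubles \<open>g\<close> in the first integral, which cancels the factor \<open>1 / 2\<close>.\<close>
  have fold: "(f a + f b) / 2 * integral {a..b} g - integral {a..b} (\<lambda>x. f x * g x)
    = - integral {a..m} (\<lambda>x. g x * (P (s x) - P 0))"
  proof -
    let ?c = "(f a + f b) / 2"
    have "?c * integral {a..b} g - integral {a..b} (\<lambda>x. f x * g x)
        = integral {a..b} (\<lambda>x. ?c * g x - f x * g x)"
      by (subst integral_diff)
        (auto intro!: integrable_continuous_real continuous_intros f_cont g_cont)
    also have "\<dots> = integral {a..m} (\<lambda>x. (?c * g x - f x * g x)
        + (?c * g (a + b - x) - f (a + b - x) * g (a + b - x)))"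
      unfolding m_def using ab
      by (intro integral_fold_at_midpoint) (auto intro!: continuous_intros f_cont g_cont)
    also have "\<dots> = integral {a..m} (\<lambda>x. - (g x * (P (s x) - P 0)))"
      using sub
      by (intro integral_cong)
        (simp add: subset_iff g_sym P_s algebra_simps add_divide_distrib)
    finally show ?thesis by simp
  qed
  have "\<bar>integral {a..m} (\<lambda>x. g x * (P (s x) - P 0))\<bar>
      \<le> integral {a..m} (\<lambda>x. g x * \<bar>P (s x) - P 0\<bar>)"
    using assms(6) sub
    by (intro integral_norm_bound_integral[where 'a = real, unfolded real_norm_def]
        integrable_continuous_real continuous_intros g_cont' D_cont)
      (auto simp: abs_mult subset_iff)
  then have "ennreal \<bar>(f a + f b) / 2 * integral {a..b} g - integral {a..b} (\<lambda>x. f x * g x)\<bar>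
      \<le> ennreal (integral {a..m} (\<lambda>x. g x * \<bar>P (s x) - P 0\<bar>))"
    unfolding fold abs_minus_cancel by (rule ennreal_leI)
  also have "\<dots> \<le> ennreal ((b - a) * M) *
      (\<integral>\<^sup>+x\<in>{a..m}. (\<integral>\<^sup>+t\<in>{0..s x}. ennreal (g x * (h t + h (1 - t))) \<partial>lebesgue) \<partial>lebesgue)"
  proof (rule weighted_increment_le_iterated_nn_integral[OF _ _ g_cont' _ _ P_der p_bound])
    show "0 \<le> (b - a) * M" using ab by (simp add: M_def)
    show "0 \<le> g x" if "x \<in> {a..m}" for x using assms(6) sub that by blast
    show "s x \<in> {0..1}" if "x \<in> {a..m}" for x using that m by (auto simp: s_def field_simps)
    show "continuous_on {a..m} s"
      unfolding s_def using ab by (intro continuous_intros) auto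
  qed
  finally show ?thesis by (simp only: M_def m_def s_def)
qed

end
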